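(* Let $n\ge 1$ be an integer and let $\hat\Theta\in\left((n-1)\frac{\pi}{2},\,n\frac{\pi}{2}\right)$. For $\lambda=(\lambda_1,\dots,\lambda_n)\in\mathbb{R}^n$ put $\theta(\lambda)=\sum_{i=1}^n\arctan\lambda_i$, and let $\mathcal{S}=\{\lambda\in\mathbb{R}^n : |\theta(\lambda)-\hat\Theta|<\frac{\pi}{2}\}$. Then the function $f:\mathcal{S}\to\mathbb{R}$, $f(\lambda)=\tan(\theta(\lambda)-\hat\Theta)$, is concave on $\mathcal{S}$.
   Context: $\arctan$ takes values in $(-\frac{\pi}{2},\frac{\pi}{2})$. *)

theory Defs
  imports "HOL-Analysis.Analysis"
begin

definition theta :: "real ^ 'n \<Rightarrow> real"
  where "theta x = (\<Sum>i\<in>UNIV. arctan (x $ i))"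

definition phase_set :: "real \<Rightarrow> (real ^ 'n) set"
  where "phase_set \<Theta> = {x. \<bar>theta x - \<Theta>\<bar> < pi / 2}"

end

theory Submission
  imports Defs
begin

text \<open>
  Write \<open>\<alpha>\<^sub>i = \<pi>/2 - arctan \<lambda>\<^sub>i\<close> for the inverse cotangents and \<open>\<gamma> = \<Theta> - (n-1)\<pi>/2 \<in> (0, \<pi>/2)\<close>. Then
  \<open>tan (\<theta>(\<lambda>) - \<Theta>) = cot (\<gamma> + \<Sum>\<alpha>\<^sub>i)\<close>, and the phase set is \<open>\<gamma> + \<Sum>\<alpha>\<^sub>i < \<pi>\<close>. The summands are added one
  at a time, by the addition formula \<open>cot (a + b) = h (cot a) (cot b)\<close> with \<open>h x y = (x y - 1) / (x + y)\<close>.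
  On \<open>x + y > 0\<close> the function \<open>h\<close> is a pointwise minimum of affine functions that are nondecreasing
  in both variables, so composing it with concave functions preserves concavity; the condition that
  the angle stays below \<open>\<pi>\<close> is \<open>x + y > 0\<close>, a superlevel set of a concave function.
\<close>

text \<open>Completing squares: the \<open>t\<close> terms bound \<open>x * y / (x + y)\<close> from
  above, and the \<open>w\<close> terms bound \<open>- 1 / (x + y)\<close>.\<close>

lemma cot_add_formula_le_affine:
  fixes x y t w :: real
  assumes "x + y > 0"
  shows "(x * y - 1) / (x + y) \<le> t\<^sup>2 * x + (1 - t)\<^sup>2 * y + w\<^sup>2 * (x + y) - 2 * w"
proof -
  have "(t\<^sup>2 * x + (1 - t)\<^sup>2 * y + w\<^sup>2 * (x + y) - 2 * w) * (x + y) - (x * y - 1)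
      = (t * (x + y) - y)\<^sup>2 + (w * (x + y) - 1)\<^sup>2"
    by (simp add: power2_eq_square algebra_simps)
  also have "\<dots> \<ge> 0"
    by simp
  finally show ?thesis
    using assms by (simp add: divide_le_eq)
qed

text \<open>This choice of \<open>t\<close> and \<open>w\<close> makes both squares vanish, so the
  affine majorant touches at \<open>(p, q)\<close>.\<close>

lemma cot_add_formula_eq_affine:
  fixes p q :: real
  assumes "p + q > 0"
  defines "t \<equiv> q / (p + q)" and "w \<equiv> 1 / (p + q)"
  shows "(p * q - 1) / (p + q) = t\<^sup>2 * p + (1 - t)\<^sup>2 * q + w\<^sup>2 * (p + q) - 2 * w"
proof -
  have q: "q = t * (p + q)" and w: "w * (p + q) = 1"
    using assms by simp_all
  have "(t\<^sup>2 * p + (1 - t)\<^sup>2 * q + w\<^sup>2 * (p + q) - 2 * w) * (p + q) - (p * q - 1)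
      = (t * (p + q) - q)\<^sup>2 + (w * (p + q) - 1)\<^sup>2"
    by (simp add: power2_eq_square algebra_simps)
  also have "\<dots> = 0"
    using q w by simp
  finally show ?thesis
    using assms(1) by (simp add: divide_eq_eq)
qed

lemma cot_add_formula_concave_mono:
  fixes u v x1 x2 y1 y2 p q :: real
  assumes "u \<ge> 0" "v \<ge> 0" "u + v = 1"
    and "x1 + y1 > 0" "x2 + y2 > 0" "p + q > 0"
    and p: "u * x1 + v * x2 \<le> p" and q: "u * y1 + v * y2 \<le> q"
  shows "u * ((x1 * y1 - 1) / (x1 + y1)) + v * ((x2 * y2 - 1) / (x2 + y2)) \<le> (p * q - 1) / (p + q)"
proof -
  define t w where "t = q / (p + q)" and "w = 1 / (p + q)"
  define L where "L x y = t\<^sup>2 * x + (1 - t)\<^sup>2 * y + w\<^sup>2 * (x + y) - 2 * w" for x y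
  have "u * ((x1 * y1 - 1) / (x1 + y1)) + v * ((x2 * y2 - 1) / (x2 + y2)) \<le> u * L x1 y1 + v * L x2 y2"
    unfolding L_def using assms by (intro add_mono mult_left_mono cot_add_formula_le_affine) auto
  also have "\<dots> = t\<^sup>2 * (u * x1 + v * x2) + (1 - t)\<^sup>2 * (u * y1 + v * y2)
      + w\<^sup>2 * ((u * x1 + v * x2) + (u * y1 + v * y2)) - 2 * (u + v) * w"
    unfolding L_def by (simp add: algebra_simps)
  \<comment> \<open>The slopes of \<open>L\<close> are sums of squares, so \<open>L\<close> is
    nondecreasing in each variable.\<close>
  also have "\<dots> \<le> L p q"
    unfolding L_def \<open>u + v = 1\<close> using p q
    by (intro diff_mono add_mono mult_left_mono) auto
  also have "\<dots> = (p * q - 1) / (p + q)"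
    unfolding L_def t_def w_def using cot_add_formula_eq_affine[OF \<open>p + q > 0\<close>] by simp
  finally show ?thesis .
qed

lemma add_arccot_less_pi_iff:
  assumes "0 < a" "a < pi"
  shows "a + (pi / 2 - arctan y) < pi \<longleftrightarrow> 0 < cot a + y"
proof -
  have "arctan (- cot a) = a - pi / 2"
  proof (rule arctan_unique)
    show "tan (a - pi / 2) = - cot a"
      using tan_cot'[of a] tan_minus[of "pi / 2 - a"] by simp
  qed (use assms in auto)
  then have "a + (pi / 2 - arctan y) < pi \<longleftrightarrow> arctan (- cot a) < arctan y"
    by auto
  then show ?thesis
    unfolding arctan_less_iff by auto
qed

text \<open>If \<open>cot a + y = 0\<close>, both sides take the default value 0 of division by
  zero.\<close>

lemma cot_add_arccot:
  assumes "sin a \<noteq> 0"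
  shows "cot (a + (pi / 2 - arctan y)) = (cot a * y - 1) / (cot a + y)"
proof -
  define r where "r = sqrt (1 + y\<^sup>2)"
  have "r \<noteq> 0"
    unfolding r_def using sum_power2_gt_zero_iff[of 1 y] by simp
  have "a + (pi / 2 - arctan y) = (a - arctan y) + pi / 2"
    by simp
  then have "cot (a + (pi / 2 - arctan y)) = - sin (a - arctan y) / cos (a - arctan y)"
    by (simp only: cot_def sin_add cos_add) simp
  also have "\<dots> = ((cos a * y - sin a) / r) / ((cos a + sin a * y) / r)"
    by (simp add: sin_diff cos_diff sin_arctan cos_arctan r_def diff_divide_distrib add_divide_distrib)
  also have "\<dots> = (cos a * y - sin a) / (cos a + sin a * y)"
    using \<open>r \<noteq> 0\<close> by simp
  also have "\<dots> = (cot a * y - 1) / (cot a + y)"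
  proof -
    have "cos a * y - sin a = sin a * (cot a * y - 1)" "cos a + sin a * y = sin a * (cot a + y)"
      using assms by (simp_all add: cot_def algebra_simps)
    then show ?thesis
      using assms by simp
  qed
  finally show ?thesis .
qed

lemma concave_on_cot_add_arccot:
  fixes A l :: "'a::real_vector \<Rightarrow> real"
  assumes pos: "\<And>x. A x > 0"
    and A: "concave_on {x. A x < pi} (\<lambda>x. cot (A x))"
    and l: "concave_on UNIV l"
  shows "concave_on {x. A x + (pi / 2 - arctan (l x)) < pi} (\<lambda>x. cot (A x + (pi / 2 - arctan (l x))))"
    (is "concave_on ?T ?g")
proof -
  \<comment> \<open>The added angle is positive, so the earlier angle \<open>A x\<close> is below
    \<pi> as well and the hypothesis on \<open>A\<close> applies.\<close>
  have *: "x \<in> ?T \<longleftrightarrow> A x < pi \<and> 0 < cot (A x) + l x" for x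
    using add_arccot_less_pi_iff[OF pos, of x "l x"] arctan_ubound[of "l x"] by auto
  have cot: "?g x = (cot (A x) * l x - 1) / (cot (A x) + l x)" if "A x < pi" for x
    using sin_gt_zero[OF pos that] by (intro cot_add_arccot) simp
  have main: "u *\<^sub>R x + v *\<^sub>R y \<in> ?T \<and> u * ?g x + v * ?g y \<le> ?g (u *\<^sub>R x + v *\<^sub>R y)"
    if x: "x \<in> ?T" and y: "y \<in> ?T" and uv: "u \<ge> 0" "v \<ge> 0" "u + v = 1" for x y u v
  proof -
    let ?z = "u *\<^sub>R x + v *\<^sub>R y"
    have xy: "A x < pi" "0 < cot (A x) + l x" "A y < pi" "0 < cot (A y) + l y"
      using x y unfolding * by auto
    have z: "A ?z < pi"
      using concave_on_imp_convex[OF A] xy uv by (auto simp: convex_def)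
    have p: "u * cot (A x) + v * cot (A y) \<le> cot (A ?z)"
      using A xy uv by (auto simp: concave_on_iff)
    have q: "u * l x + v * l y \<le> l ?z"
      using l uv by (auto simp: concave_on_iff)
    have "0 < u * (cot (A x) + l x) + v * (cot (A y) + l y)"
      using xy uv by (cases "u = 0") (auto intro!: add_pos_nonneg)
    with p q have s: "0 < cot (A ?z) + l ?z"
      by (simp add: algebra_simps)
    show ?thesis
      using cot_add_formula_concave_mono[OF uv xy(2,4) s p q] z s * cot xy by auto
  qed
  then show ?thesis
    by (auto simp: concave_on_iff convex_def)
qed

lemma sum_arccot_nonneg: "(\<Sum>i\<in>F. pi / 2 - arctan (f i)) \<ge> 0"
  using arctan_ubound by (intro sum_nonneg) (simp add: less_imp_le)

text \<open>Partial sums over \<open>F\<close> allow induction on the set of coordinates; \<gamma> >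
  0 keeps every partial angle positive.\<close>

lemma concave_on_cot_add_sum_arccot:
  fixes \<gamma> :: real and F :: "'n::finite set"
  assumes "\<gamma> > 0"
  defines "A \<equiv> \<lambda>F (x :: real ^ 'n). \<gamma> + (\<Sum>i\<in>F. pi / 2 - arctan (x $ i))"
  shows "concave_on {x. A F x < pi} (\<lambda>x. cot (A F x))"
proof (induction F rule: finite_induct[OF finite])
  \<comment> \<open>The function is constant, and its domain is empty or the whole space.\<close>
  case 1
  then show ?case
    by (simp add: A_def concave_on_const)
next
  case (2 i F)
  have "A F x > 0" for x
    unfolding A_def using \<open>\<gamma> > 0\<close> by (intro add_pos_nonneg sum_arccot_nonneg)
  moreover have "concave_on UNIV (\<lambda>x :: real ^ 'n. x $ i)"
    by (simp add: concave_on_iff)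
  ultimately have "concave_on {x. A F x + (pi / 2 - arctan (x $ i)) < pi}
      (\<lambda>x. cot (A F x + (pi / 2 - arctan (x $ i))))"
    by (intro concave_on_cot_add_arccot 2)
  moreover have "A (insert i F) x = A F x + (pi / 2 - arctan (x $ i))" for x
    using 2 by (simp add: A_def)
  ultimately show ?case
    by simp
qed

theorem theorem1p1:
  fixes \<Theta> :: real
  assumes "\<Theta> \<in> {(real CARD('n::finite) - 1) * (pi / 2) <..< real CARD('n) * (pi / 2)}"
  shows "concave_on (phase_set \<Theta> :: (real ^ 'n) set) (\<lambda>x. tan (theta x - \<Theta>))"
proof -
  define \<gamma> where "\<gamma> = \<Theta> - (real CARD('n) - 1) * (pi / 2)"
  define A where "A x = \<gamma> + (\<Sum>i\<in>UNIV. pi / 2 - arctan (x $ i))" for x :: "real ^ 'n"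
  have "\<gamma> > 0"
    using assms by (simp add: \<gamma>_def)
  have A: "A x = pi / 2 - (theta x - \<Theta>)" for x
    by (simp add: A_def \<gamma>_def theta_def sum_subtractf) (simp add: field_simps)
  have A_pos: "A x > 0" for x
    unfolding A_def using \<open>\<gamma> > 0\<close> by (intro add_pos_nonneg sum_arccot_nonneg)
  \<comment> \<open>\<open>A x > 0\<close> is the bound \<open>theta x - \<Theta> < pi / 2\<close>,
    and \<open>A x < pi\<close> is the opposite one.\<close>
  have "\<bar>theta x - \<Theta>\<bar> < pi / 2 \<longleftrightarrow> A x < pi" for x
    using A_pos[of x] unfolding A by arith
  then have "phase_set \<Theta> = {x. A x < pi}"
    by (simp add: phase_set_def)
  moreover have "cot (A x) = tan (theta x - \<Theta>)" for x
    unfolding A by (metis tan_cot' diff_diff_eq2 add_diff_cancel_left')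
  moreover have "concave_on {x. A x < pi} (\<lambda>x. cot (A x))"
    unfolding A_def by (intro concave_on_cot_add_sum_arccot \<open>\<gamma> > 0\<close>)
  ultimately show ?thesis
    by simp
qed

end
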